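(* Let $f:\mathbb{R}^d\to\mathbb{R}$ be differentiable and $\mu$-strongly convex with $\mu>0$, and suppose $f$ is matrix smooth with matrix $\mathbb{L}$ and the sketch moment conditions hold (both as in the context). Consider the full-sketch case $r=d$, and assume that $P_kP_k^\top=I_d$ for all $k\ge0$ (which is the case, for example, for the Haar and block coordinate sketches with $r=d$). Then the sketch moment conditions are satisfied with $\omega=1$, $\ell=1$. With this choice of $\omega,\ell$, the $(x_k,y_k)$-sequence generated by algorithm RS-NAG-SC (as in the context) from $x_0$ coincides with the classical two-sequence Nesterov accelerated gradient method for strongly convex objectives started at $x_0$, i.e. $x_k=x_k^{\mathrm N}$ and $y_k=y_k^{\mathrm N}$ for all $k\ge0$, where $x_0^{\mathrm N}=y_0^{\mathrm N}=x_0$ and for $k\ge0$ $$x_{k+1}^{\mathrm N}=y_k^{\mathrm N}-\tfrac1L\nabla f(y_k^{\mathrm N}),\qquad y_{k+1}^{\mathrm N}=x_{k+1}^{\mathrm N}+\beta(x_{k+1}^{\mathrm N}-x_k^{\mathrm N}),\qquad \beta=\frac{\sqrt L-\sqrt\mu}{\sqrt L+\sqrt\mu}.$$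
   Context: Standing assumption: $d\ge2$. $\|\cdot\|$ is the Euclidean norm for vectors and the induced operator norm for matrices; $A\preceq B$ means $B-A$ is positive semidefinite. Matrix smoothness: there is a fixed symmetric matrix $\mathbb{L}\in\mathbb{R}^{d\times d}$, $\mathbb{L}\succeq0$, $\mathbb{L}\ne0$, such that for all $x,y\in\mathbb{R}^d$, $f(y)\le f(x)+\langle\nabla f(x),y-x\rangle+\tfrac12(y-x)^\top\mathbb{L}(y-x)$. Put $L:=\|\mathbb{L}\|$. Sketch moment conditions with constants $\omega>0,\ell>0$ for a random matrix $P\in\mathbb{R}^{d\times r}$: $\mathbb{E}[PP^\top]=I_d$, $\mathbb{E}[(PP^\top)^2]\preceq\omega I_d$, $\mathbb{E}[PP^\top\mathbb{L}PP^\top]\preceq\ell L\,I_d$. The sketches $P_k$ are i.i.d. copies of $P$. Haar sketch: $P=\sqrt{d/r}\,R$ with $R$ the first $r$ columns of a Haar-distributed orthogonal $d\times d$ matrix. (Block) coordinate sketch: $P=\sqrt{d/r}\,S$ with $S$ consisting of $r$ uniformly sampled distinct columns of $I_d$. Algorithm RS-NAG-SC: given $x_0\in\mathbb{R}^d$ and i.i.d. sketches $P_k$, set $\theta=\sqrt{\mu/(L\omega\ell)}$, $z_0=x_0$, and for $k=0,1,2,\dots$: $y_k=\dfrac1{1+\theta}x_k+\dfrac{\theta}{1+\theta}z_k$, $x_{k+1}=y_k-\dfrac1{L\ell}P_kP_k^\top\nabla f(y_k)$, $z_{k+1}=(1-\theta)z_k+\theta y_k-\dfrac{\theta}{\mu}P_kP_k^\top\nabla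 f(y_k)$. *)

theory Defs
  imports "HOL-Probability.Probability"
begin

definition psd :: "real^'n^'n \<Rightarrow> bool" where
  "psd A \<longleftrightarrow> transpose A = A \<and> (\<forall>x. 0 \<le> x \<bullet> (A *v x))"

definition loewner_le :: "real^'n^'n \<Rightarrow> real^'n^'n \<Rightarrow> bool" (infix "\<preceq>" 50) where
  "A \<preceq> B \<longleftrightarrow> psd (B - A)"

definition opnorm :: "real^'n^'m \<Rightarrow> real" where
  "opnorm A = onorm (\<lambda>x. A *v x)"

definition gradient :: "('a::real_inner \<Rightarrow> real) \<Rightarrow> 'a \<Rightarrow> 'a" where
  "gradient f x = (THE g. GDERIV f x :> g)"

lemma gradient_eqI:
  assumes "GDERIV f x :> g"
  shows "gradient f x = g"
  unfolding gradient_def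
proof (rule the_equality)
  fix h assume "GDERIV f x :> h"
  then have "(\<lambda>v. v \<bullet> h) = (\<lambda>v. v \<bullet> g)"
    using assms unfolding gderiv_def by (rule has_derivative_unique)
  then show "h = g"
    by (metis vector_eq_ldot)
qed (fact assms)

definition strongly_convex :: "real \<Rightarrow> ('a::real_inner \<Rightarrow> real) \<Rightarrow> bool" where
  "strongly_convex \<mu> f \<longleftrightarrow>
     (\<forall>x y t. 0 \<le> t \<and> t \<le> 1 \<longrightarrow>
        f (t *\<^sub>R x + (1 - t) *\<^sub>R y)
          \<le> t * f x + (1 - t) * f y - \<mu> / 2 * t * (1 - t) * (norm (x - y))\<^sup>2)"

definition matrix_smooth :: "(real^'d \<Rightarrow> real) \<Rightarrow> real^'d^'d \<Rightarrow> bool" where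
  "matrix_smooth f LL \<longleftrightarrow>
     psd LL \<and> LL \<noteq> 0 \<and>
     (\<forall>x y. f y \<le> f x + gradient f x \<bullet> (y - x) + 1 / 2 * ((y - x) \<bullet> (LL *v (y - x))))"

definition sketch_moments ::
  "'w measure \<Rightarrow> ('w \<Rightarrow> real^'r^'d) \<Rightarrow> real^'d^'d \<Rightarrow> real \<Rightarrow> real \<Rightarrow> bool" where
  "sketch_moments M P LL \<omega> l \<longleftrightarrow>
     (let PPT = (\<lambda>s. P s ** transpose (P s)) in
        0 < \<omega> \<and> 0 < l \<and>
        integrable M PPT \<and> integral\<^sup>L M PPT = mat 1 \<and>
        integrable M (\<lambda>s. PPT s ** PPT s) \<and>
        integral\<^sup>L M (\<lambda>s. PPT s ** PPT s) \<preceq> \<omega> *\<^sub>R mat 1 \<and>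
        integrable M (\<lambda>s. PPT s ** LL ** PPT s) \<and>
        integral\<^sup>L M (\<lambda>s. PPT s ** LL ** PPT s) \<preceq> (l * opnorm LL) *\<^sub>R mat 1)"

definition iid_copies ::
  "'w measure \<Rightarrow> ('w \<Rightarrow> 'a::topological_space) \<Rightarrow> (nat \<Rightarrow> 'w \<Rightarrow> 'a) \<Rightarrow> bool" where
  "iid_copies M X Xs \<longleftrightarrow>
     X \<in> borel_measurable M \<and>
     prob_space.indep_vars M (\<lambda>_. borel) Xs UNIV \<and>
     (\<forall>k. distr M borel (Xs k) = distr M borel X)"

text \<open>Haar measure on the orthogonal group, viewed as a law on all matrices: it is the only
  left-invariant probability law concentrated on the orthogonal matrices.\<close>

definition haar_orthogonal :: "'w measure \<Rightarrow> ('w \<Rightarrow> real^'d^'d) \<Rightarrow> bool" where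
  "haar_orthogonal M Q \<longleftrightarrow>
     Q \<in> borel_measurable M \<and>
     (AE s in M. orthogonal_matrix (Q s)) \<and>
     (\<forall>U. orthogonal_matrix U \<longrightarrow> distr M borel (\<lambda>s. U ** Q s) = distr M borel Q)"

text \<open>The index types carry no order, so the first \<open>r\<close> columns are the columns listed by an
  injection \<open>e\<close> of the \<open>r\<close> column indices. The law of the sketch does not depend on \<open>e\<close>.\<close>

definition haar_sketch :: "'w measure \<Rightarrow> ('w \<Rightarrow> real^'r^'d) \<Rightarrow> bool" where
  "haar_sketch M P \<longleftrightarrow>
     (\<exists>Q e. haar_orthogonal M Q \<and> inj (e :: 'r \<Rightarrow> 'd) \<and>
        (\<forall>s\<in>space M. P s = sqrt (real CARD('d) / real CARD('r)) *\<^sub>R (\<chi> i j. Q s $ i $ e j)))"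

text \<open>Here \<open>\<sigma> s j\<close> is the index of the \<open>j\<close>-th sampled column of the identity. Only the set of
  sampled columns is required to be uniform; the order in which they are listed is arbitrary.\<close>

definition coordinate_sketch :: "'w measure \<Rightarrow> ('w \<Rightarrow> real^'r^'d) \<Rightarrow> bool" where
  "coordinate_sketch M P \<longleftrightarrow>
     (\<exists>\<sigma> :: 'w \<Rightarrow> 'r \<Rightarrow> 'd.
        \<sigma> \<in> measurable M (count_space UNIV) \<and>
        (\<forall>s\<in>space M. inj (\<sigma> s)) \<and>
        distr M (count_space UNIV) (\<lambda>s. range (\<sigma> s))
          = measure_pmf (pmf_of_set {J. card J = CARD('r)}) \<and>
        (\<forall>s\<in>space M. P s = sqrt (real CARD('d) / real CARD('r)) *\<^sub>R
                              (\<chi> i j. (mat 1 :: real^'d^'d) $ i $ \<sigma> s j)))"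

text \<open>\<open>P\<close> is one realization of the sketch sequence.\<close>

definition rs_nag_sc ::
  "(real^'d \<Rightarrow> real) \<Rightarrow> real \<Rightarrow> real \<Rightarrow> real \<Rightarrow> real \<Rightarrow> (nat \<Rightarrow> real^'r^'d) \<Rightarrow> real^'d \<Rightarrow>
   (nat \<Rightarrow> real^'d) \<Rightarrow> (nat \<Rightarrow> real^'d) \<Rightarrow> (nat \<Rightarrow> real^'d) \<Rightarrow> bool" where
  "rs_nag_sc f L \<mu> \<omega> l P x0 x y z \<longleftrightarrow>
     (let \<theta> = sqrt (\<mu> / (L * \<omega> * l));
          g = (\<lambda>k. (P k ** transpose (P k)) *v gradient f (y k))
      in x 0 = x0 \<and> z 0 = x0 \<and>
         (\<forall>k. y k = (1 / (1 + \<theta>)) *\<^sub>R x k + (\<theta> / (1 + \<theta>)) *\<^sub>R z k \<and>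
              x (Suc k) = y k - (1 / (L * l)) *\<^sub>R g k \<and>
              z (Suc k) = (1 - \<theta>) *\<^sub>R z k + \<theta> *\<^sub>R y k - (\<theta> / \<mu>) *\<^sub>R g k))"

definition nesterov_sc ::
  "(real^'d \<Rightarrow> real) \<Rightarrow> real \<Rightarrow> real \<Rightarrow> real^'d \<Rightarrow>
   (nat \<Rightarrow> real^'d) \<Rightarrow> (nat \<Rightarrow> real^'d) \<Rightarrow> bool" where
  "nesterov_sc f L \<mu> x0 x y \<longleftrightarrow>
     (let \<beta> = (sqrt L - sqrt \<mu>) / (sqrt L + sqrt \<mu>)
      in x 0 = x0 \<and> y 0 = x0 \<and>
         (\<forall>k. x (Suc k) = y k - (1 / L) *\<^sub>R gradient f (y k) \<and>
              y (Suc k) = x (Suc k) + \<beta> *\<^sub>R (x (Suc k) - x k)))"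

end

theory Submission
  imports Defs
begin

text \<open>If \<open>P\<^sub>k P\<^sub>k\<^sup>T = I\<close>, then eliminating \<open>z\<close> with \<open>\<theta>\<^sup>2 / \<mu> = 1 / L\<close> gives
  \<open>\<theta> z\<^bsub>k+1\<^esub> = x\<^bsub>k+1\<^esub> - (1 - \<theta>) x\<^sub>k\<close>. Substituting this into the definition of \<open>y\<^bsub>k+1\<^esub>\<close> yields
  the momentum step with \<open>\<beta> = (1 - \<theta>) / (1 + \<theta>)\<close>.\<close>

text \<open>Supplies \<open>L > 0\<close>, so that \<open>1 / L\<close> and \<theta> are genuine
  quantities and not the totalized values of division by zero.\<close>

lemma opnorm_pos:
  fixes A :: "real^'n^'m"
  assumes "A \<noteq> 0"
  shows "opnorm A > 0"
proof -
  have bl: "bounded_linear (\<lambda>x. A *v x)"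
    by (rule matrix_vector_mul_bounded_linear)
  obtain x where "A *v x \<noteq> 0 *v x"
    using assms matrix_eq[of A 0] by blast
  then have "\<not> (\<forall>x. A *v x = 0)" by auto
  then show ?thesis
    using onorm_pos_lt[OF bl] by (auto simp: opnorm_def)
qed

text \<open>Cauchy-Schwarz followed by the operator norm bound controls the quadratic form. This is
  the third moment condition with \<open>l = 1\<close> once the sketch has dropped out.\<close>

lemma psd_loewner_le_opnorm:
  fixes A :: "real^'n^'n"
  assumes "psd A"
  shows "A \<preceq> opnorm A *\<^sub>R mat 1"
  unfolding loewner_le_def psd_def
proof (intro conjI allI)
  have "transpose A = A" using assms by (simp add: psd_def)
  then show "transpose (opnorm A *\<^sub>R mat 1 - A) = opnorm A *\<^sub>R mat 1 - A"
    by (simp add: transpose_def vec_eq_iff mat_def eq_commute)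
next
  fix x :: "real^'n"
  have "x \<bullet> (A *v x) \<le> norm x * norm (A *v x)" by (rule norm_cauchy_schwarz)
  also have "\<dots> \<le> norm x * (opnorm A * norm x)"
    unfolding opnorm_def
    by (intro mult_left_mono onorm matrix_vector_mul_bounded_linear norm_ge_zero)
  also have "\<dots> = x \<bullet> (opnorm A *\<^sub>R x)"
    by (simp add: dot_square_norm power2_eq_square)
  finally show "0 \<le> x \<bullet> ((opnorm A *\<^sub>R mat 1 - A) *v x)"
    by (simp add: matrix_vector_mult_diff_rdistrib scaleR_matrix_vector_assoc[symmetric] inner_diff_right)
qed

text \<open>Equal cardinality turns the injection \<open>e\<close> into a bijection, so each entry
  of \<open>B ** transpose B\<close> is the corresponding sum for \<open>A\<close> with its terms
  reindexed. The types \<open>'r\<close> and \<open>'d\<close> stay distinct, hence the cardinality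
  hypothesis.\<close>

lemma permuted_columns_orthogonal:
  fixes A :: "real^'d^'d" and e :: "'r::finite \<Rightarrow> 'd"
  assumes "orthogonal_matrix A" "inj e" "CARD('r) = CARD('d)"
  defines "B \<equiv> \<chi> i j. A $ i $ e j"
  shows "B ** transpose B = mat 1"
proof -
  have "range e = UNIV"
    by (rule card_subset_eq) (use assms in \<open>simp_all add: card_image\<close>)
  then have "bij_betw e UNIV UNIV"
    using assms(2) by (simp add: bij_betw_def)
  then have "B ** transpose B = A ** transpose A"
    by (simp add: B_def vec_eq_iff matrix_matrix_mult_def transpose_def
        sum.reindex_bij_betw[of e UNIV UNIV "\<lambda>j. A $ _ $ j * A $ _ $ j"])
  then show ?thesis
    using assms(1) by (simp add: orthogonal_matrix_def)
qed

lemma haar_sketch_full: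
  fixes Q :: "'w \<Rightarrow> real^'r^'d"
  assumes "haar_sketch M Q" "CARD('r) = CARD('d)"
  shows "AE s in M. Q s ** transpose (Q s) = mat 1"
proof -
  obtain H :: "'w \<Rightarrow> real^'d^'d" and e :: "'r \<Rightarrow> 'd"
    where "haar_orthogonal M H" "inj e"
      \<comment> \<open>The scaling factor \<open>sqrt (d / r)\<close> equals 1 here.\<close>
      and Q: "\<forall>s\<in>space M. Q s = (\<chi> i j. H s $ i $ e j)"
    using assms by (auto simp: haar_sketch_def)
  then have "AE s in M. orthogonal_matrix (H s)"
    by (simp add: haar_orthogonal_def)
  with AE_space show ?thesis
    by eventually_elim
      (simp add: Q permuted_columns_orthogonal[OF _ \<open>inj e\<close> assms(2)])
qed

text \<open>Sampling all the columns of the identity gives a permutation matrix: the identity takes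
  the place of the Haar matrix.\<close>

lemma coordinate_sketch_full:
  fixes Q :: "'w \<Rightarrow> real^'r^'d"
  assumes "coordinate_sketch M Q" "CARD('r) = CARD('d)"
  shows "AE s in M. Q s ** transpose (Q s) = mat 1"
proof -
  obtain \<sigma> :: "'w \<Rightarrow> 'r \<Rightarrow> 'd" where inj: "\<forall>s\<in>space M. inj (\<sigma> s)"
    and Q: "\<forall>s\<in>space M. Q s = (\<chi> i j. (mat 1 :: real^'d^'d) $ i $ \<sigma> s j)"
    using assms by (auto simp: coordinate_sketch_def)
  show ?thesis
    by (rule AE_I2)
      (use inj Q permuted_columns_orthogonal[OF orthogonal_matrix_id _ assms(2)] in auto)
qed

text \<open>The hypothesis concerns the copies, the moment conditions concern \<open>P\<close>. The
  property depends only on the law, which they share, provided that it defines a Borel set; this set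
  is closed because the matrix entries involved are polynomials.\<close>

lemma iid_copies_AE_orthogonal:
  fixes P :: "'w \<Rightarrow> real^'r^'d"
  assumes M: "prob_space M" and iid: "iid_copies M P Ps"
    and AE: "AE s in M. Ps k s ** transpose (Ps k s) = mat 1"
  shows "AE s in M. P s ** transpose (P s) = mat 1"
proof -
  let ?C = "{A :: real^'r^'d. A ** transpose A = mat 1}"
  have "closed ?C"
    unfolding matrix_matrix_mult_def transpose_def
    by (intro closed_Collect_eq continuous_intros)
  then have C: "?C \<in> sets borel" by (rule borel_closed)
  have P: "P \<in> borel_measurable M" and distr: "distr M borel (Ps k) = distr M borel P"
    using iid by (auto simp: iid_copies_def)
  \<comment> \<open>Measurability of the copies is part of independence.\<close>
  have "Ps k \<in> borel_measurable M"
    using iid by (simp add: iid_copies_def prob_space.indep_vars_def2[OF M])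
  then have "AE A in distr M borel (Ps k). A \<in> ?C"
    using AE C by (simp add: AE_distr_iff)
  then have "AE A in distr M borel P. A \<in> ?C"
    by (simp only: distr)
  then show ?thesis
    using P C by (simp add: AE_distr_iff)
qed

text \<open>Almost surely the three integrands are the constants \<open>mat 1\<close>,
  \<open>mat 1\<close> and \<open>LL\<close>. The assumed moment conditions, with arbitrary
  constants, provide integrability and the first moment.\<close>

lemma sketch_moments_orthogonal:
  fixes P :: "'w \<Rightarrow> real^'r^'d"
  assumes M: "prob_space M" and LL: "psd LL" and moments: "sketch_moments M P LL \<omega> l"
    and AE: "AE s in M. P s ** transpose (P s) = mat 1"
  shows "sketch_moments M P LL 1 1"
proof -
  interpret prob_space M by (rule M)
  have const: "integral\<^sup>L M g = c"
    if "integrable M g" "AE s in M. g s = c" for g :: "'w \<Rightarrow> real^'d^'d" and c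
  proof -
    have "integral\<^sup>L M g = integral\<^sup>L M (\<lambda>_. c)"
      by (rule integral_cong_AE) (use that in auto)
    then show ?thesis by (simp add: prob_space)
  qed
  let ?A = "\<lambda>s. P s ** transpose (P s)"
  have i2: "integrable M (\<lambda>s. ?A s ** ?A s)" and i3: "integrable M (\<lambda>s. ?A s ** LL ** ?A s)"
    using moments by (simp_all add: sketch_moments_def Let_def)
  have e2: "integral\<^sup>L M (\<lambda>s. ?A s ** ?A s) = mat 1"
    by (rule const[OF i2]) (use AE in eventually_elim, simp)
  have e3: "integral\<^sup>L M (\<lambda>s. ?A s ** LL ** ?A s) = LL"
    by (rule const[OF i3]) (use AE in eventually_elim, simp)
  have "(mat 1 :: real^'d^'d) \<preceq> 1 *\<^sub>R mat 1"
    by (simp add: loewner_le_def psd_def transpose_def vec_eq_iff)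
  moreover have "LL \<preceq> (1 * opnorm LL) *\<^sub>R mat 1"
    using psd_loewner_le_opnorm[OF LL] by simp
  ultimately show ?thesis
    using moments unfolding sketch_moments_def Let_def e2 e3 by simp
qed

lemma rs_nag_sc_y_Suc:
  fixes P :: "nat \<Rightarrow> real^'r^'d"
  assumes "L > 0" "\<mu> > 0" and alg: "rs_nag_sc f L \<mu> 1 1 P x0 x y z"
    and PPT: "P k ** transpose (P k) = mat 1"
  shows "y (Suc k) = x (Suc k)
    + ((sqrt L - sqrt \<mu>) / (sqrt L + sqrt \<mu>)) *\<^sub>R (x (Suc k) - x k)"
proof -
  define \<theta> where "\<theta> = sqrt (\<mu> / L)"
  have \<theta>: "\<theta> > 0" using assms by (simp add: \<theta>_def)
  \<comment> \<open>With this choice of \<theta>, the gradient enters \<open>\<theta> z\<close> with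
    the same coefficient as in the update of \<open>x\<close>.\<close>
  have sq: "\<theta> * \<theta> / \<mu> = 1 / L" using assms by (simp add: \<theta>_def)
  have \<beta>: "(sqrt L - sqrt \<mu>) / (sqrt L + sqrt \<mu>) = (1 - \<theta>) / (1 + \<theta>)"
  proof -
    have "sqrt \<mu> = sqrt L * \<theta>" using assms by (simp add: \<theta>_def real_sqrt_divide)
    then have "(sqrt L - sqrt \<mu>) / (sqrt L + sqrt \<mu>)
        = (sqrt L * (1 - \<theta>)) / (sqrt L * (1 + \<theta>))"
      by (simp add: algebra_simps)
    then show ?thesis using assms by simp
  qed
  define g where "g = gradient f (y k)"
  have y: "y j = (1 / (1 + \<theta>)) *\<^sub>R x j + (\<theta> / (1 + \<theta>)) *\<^sub>R z j" for j
    using alg by (simp add: rs_nag_sc_def Let_def \<theta>_def)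
  have x: "x (Suc k) = y k - (1 / L) *\<^sub>R g"
    and z: "z (Suc k) = (1 - \<theta>) *\<^sub>R z k + \<theta> *\<^sub>R y k - (\<theta> / \<mu>) *\<^sub>R g"
    using alg PPT by (simp_all add: rs_nag_sc_def Let_def \<theta>_def g_def)
  show ?thesis unfolding vec_eq_iff \<beta>
  proof
    fix i
    \<comment> \<open>Clearing the denominator lets \<open>\<theta> z\<close> be read off from
      \<open>x\<close> and \<open>y\<close>; it is used at \<open>k\<close> to eliminate the old
      \<open>z\<close> and at \<open>Suc k\<close> to eliminate the new one.\<close>
    have y': "(1 + \<theta>) * y j $ i = x j $ i + \<theta> * z j $ i" for j
    proof -
      have "y j $ i = (x j $ i + \<theta> * z j $ i) / (1 + \<theta>)"
        by (simp add: y add_divide_distrib)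
      then show ?thesis using \<theta> by simp
    qed
    have xi: "x (Suc k) $ i = y k $ i - 1 / L * g $ i" by (simp add: x)
    have "\<theta> * z (Suc k) $ i = (1 - \<theta>) * (\<theta> * z k $ i) + \<theta> * \<theta> * y k $ i - (\<theta> * \<theta> / \<mu>) * g $ i"
      by (simp add: z algebra_simps)
    also have "\<theta> * z k $ i = (1 + \<theta>) * y k $ i - x k $ i"
      using y'[of k] by simp
    \<comment> \<open>The coefficient of \<open>y k\<close> collapses, since
      \<open>(1 - \<theta>) * (1 + \<theta>) + \<theta> * \<theta> = 1\<close>; together with the
      gradient term this is exactly \<open>x (Suc k)\<close>.\<close>
    finally have "\<theta> * z (Suc k) $ i = x (Suc k) $ i - (1 - \<theta>) * x k $ i"
      by (simp add: sq xi algebra_simps)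
    with y'[of "Suc k"]
    have "(1 + \<theta>) * y (Suc k) $ i = (1 + \<theta>) * x (Suc k) $ i + (1 - \<theta>) * (x (Suc k) $ i - x k $ i)"
      by (simp add: algebra_simps)
    then have "y (Suc k) $ i
        = ((1 + \<theta>) * x (Suc k) $ i + (1 - \<theta>) * (x (Suc k) $ i - x k $ i)) / (1 + \<theta>)"
      using \<theta> by (simp add: eq_divide_eq mult.commute)
    then show "y (Suc k) $ i
        = (x (Suc k) + ((1 - \<theta>) / (1 + \<theta>)) *\<^sub>R (x (Suc k) - x k)) $ i"
      using \<theta> by (simp add: add_divide_distrib)
  qed
qed

text \<open>Both claims go through one induction: the gradient step needs equality of
  \<open>y k\<close>, and the momentum step also that of \<open>x k\<close>.\<close>

lemma rs_nag_sc_eq_nesterov_sc: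
  fixes P :: "nat \<Rightarrow> real^'r^'d"
  assumes L: "L > 0" and \<mu>: "\<mu> > 0" and alg: "rs_nag_sc f L \<mu> 1 1 P x0 x y z"
    and PPT: "\<And>k. P k ** transpose (P k) = mat 1"
    and nesterov: "nesterov_sc f L \<mu> x0 xN yN"
  shows "x k = xN k \<and> y k = yN k"
proof (induction k)
  case 0
  define \<theta> where "\<theta> = sqrt (\<mu> / L)"
  have \<theta>: "\<theta> > 0" using L \<mu> by (simp add: \<theta>_def)
  have "x 0 = x0" "y 0 = (1 / (1 + \<theta>)) *\<^sub>R x0 + (\<theta> / (1 + \<theta>)) *\<^sub>R x0"
    using alg by (simp_all add: rs_nag_sc_def Let_def \<theta>_def)
  \<comment> \<open>As \<open>z 0 = x 0\<close>, the first average is \<open>x0\<close> itself,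
    which matches the Nesterov start.\<close>
  moreover have "1 / (1 + \<theta>) + \<theta> / (1 + \<theta>) = 1"
    using \<theta> by (simp add: add_divide_distrib[symmetric])
  ultimately have "x 0 = x0" "y 0 = x0"
    by (simp_all flip: scaleR_add_left)
  then show ?case using nesterov by (simp add: nesterov_sc_def Let_def)
next
  case (Suc k)
  have "x (Suc k) = y k - (1 / L) *\<^sub>R gradient f (y k)"
    using alg PPT by (simp add: rs_nag_sc_def Let_def)
  with Suc rs_nag_sc_y_Suc[OF L \<mu> alg PPT] nesterov show ?case
    by (simp add: nesterov_sc_def Let_def)
qed

theorem proposition4p2:
  fixes f :: "real^'d \<Rightarrow> real" and LL :: "real^'d^'d" and \<mu> \<omega>0 l0 :: real
    and M :: "'w measure"
    and P :: "'w \<Rightarrow> real^'r^'d" and Ps :: "nat \<Rightarrow> 'w \<Rightarrow> real^'r^'d"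
    and x0 :: "real^'d"
    and x y z :: "nat \<Rightarrow> 'w \<Rightarrow> real^'d"
    and xN yN :: "nat \<Rightarrow> real^'d"
  assumes d_ge_2: "CARD('d) \<ge> 2"
    and full_sketch: "CARD('r) = CARD('d)"
    and f_diff: "\<forall>u. f differentiable (at u)"
    and mu_pos: "\<mu> > 0"
    and f_strongly_convex: "strongly_convex \<mu> f"
    and f_smooth: "matrix_smooth f LL"
    and M: "prob_space M"
    and sketches: "iid_copies M P Ps"
    and moments: "sketch_moments M P LL \<omega>0 l0"
    and PPT: "AE s in M. \<forall>k. Ps k s ** transpose (Ps k s) = mat 1"
    and alg: "\<forall>s\<in>space M. rs_nag_sc f (opnorm LL) \<mu> 1 1 (\<lambda>k. Ps k s) x0
                (\<lambda>k. x k s) (\<lambda>k. y k s) (\<lambda>k. z k s)"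
    and nesterov: "nesterov_sc f (opnorm LL) \<mu> x0 xN yN"
  shows "(\<forall>Q :: 'w \<Rightarrow> real^'r^'d. haar_sketch M Q \<or> coordinate_sketch M Q \<longrightarrow>
            (AE s in M. Q s ** transpose (Q s) = mat 1))
       \<and> sketch_moments M P LL 1 1
       \<and> (AE s in M. \<forall>k. x k s = xN k \<and> y k s = yN k)
       \<and> (\<forall>s\<in>space M. (\<forall>k. Ps k s ** transpose (Ps k s) = mat 1) \<longrightarrow>
            (\<forall>k. x k s = xN k \<and> y k s = yN k))"
proof -
  have LL: "psd LL" and "LL \<noteq> 0"
    using f_smooth by (simp_all add: matrix_smooth_def)
  then have L: "opnorm LL > 0" by (simp add: opnorm_pos)
  have full: "AE s in M. Q s ** transpose (Q s) = mat 1"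
    if "haar_sketch M Q \<or> coordinate_sketch M Q" for Q :: "'w \<Rightarrow> real^'r^'d"
    using that haar_sketch_full coordinate_sketch_full full_sketch by blast
  \<comment> \<open>Any index would do, as every copy has the law of \<open>P\<close>.\<close>
  have "AE s in M. Ps 0 s ** transpose (Ps 0 s) = mat 1"
    using PPT by eventually_elim simp
  then have mom: "sketch_moments M P LL 1 1"
    by (intro sketch_moments_orthogonal[OF M LL moments] iid_copies_AE_orthogonal[OF M sketches])
  \<comment> \<open>The comparison is made for one realization at a time; the almost sure version
    follows by restricting to outcomes where all sketches satisfy the identity.\<close>
  have eq: "\<forall>k. x k s = xN k \<and> y k s = yN k"
    if "s \<in> space M" "\<forall>k. Ps k s ** transpose (Ps k s) = mat 1" for s
    using rs_nag_sc_eq_nesterov_sc[OF L mu_pos bspec[OF alg that(1)] _ nesterov] that(2) by blast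
  have "AE s in M. \<forall>k. x k s = xN k \<and> y k s = yN k"
    using AE_space PPT by eventually_elim (rule eq)
  with full mom eq show ?thesis by blast
qed

end
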